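(* For $n\geq 1$, $$S_{n+1}(x)=(n+x)S_n(x)+(1-x^2)\sum_{r=2}^n\binom{n}{r-2}(-1)^{n-r+1}(1-x^2)^{\lfloor (n-r)/2\rfloor}S_{r-1}(x),$$ $$R_{n+1}(x)=2xR_n(x)+\sum_{r=2}^{n}\binom{n-1}{r-2}(-1)^{n-r}(1-x^2)^{\lfloor (n-r+1)/2\rfloor}R_r(x).$$ Consequently, $S_n(x)$ is divisible by $(1+x)^{\lfloor n/2\rfloor}$ for $n\geq 1$, and $R_n(x)$ is divisible by $(1+x)^{\lfloor n/2\rfloor-1}$ for $n\geq 2$.
   Context: For $\pi=\pi(1)\cdots\pi(n)$ in the symmetric group $\mathfrak{S}_n$, an alternating run is a maximal segment of consecutive entries (of length at least two) that is increasing or decreasing; $\mathrm{run}(\pi)$ is the number of alternating runs (so $\mathrm{run}=0$ when $n=1$). The type $A$ alternating run polynomials are $R_n(x)=\sum_{\pi\in\mathfrak{S}_n}x^{\mathrm{run}(\pi)}$ for $n\ge 1$ (so $R_1(x)=1$, $R_2(x)=2x$, $R_3(x)=2x+4x^2$). The up-down run polynomials are $S_n(x)=\sum_{\pi\in\mathfrak{S}_n}x^{\mathrm{as}(\pi)}$, where $\mathrm{as}(\pi)$ is the number of alternating runs of the word $0\,\pi(1)\cdots\pi(n)$ (equivalently, the maximal length $k$ of a subsequence with $\pi(i_1)>\pi(i_2)<\pi(i_3)>\cdots\pi(i_k)$, $i_1<\cdots<i_k$); $S_0(x)=1$, $S_1(x)=x$, $S_2(x)=x+x^2$. *)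

theory Defs
  imports
    "HOL-Combinatorics.Permutations"
    "HOL-Computational_Algebra.Polynomial"
begin

definition monotone_segment :: "nat list \<Rightarrow> nat \<Rightarrow> nat \<Rightarrow> bool" where
  "monotone_segment w i j \<longleftrightarrow>
     i < j \<and> j < length w \<and>
     (monotone_on {i..j} (<) (<) (\<lambda>k. w ! k) \<or> monotone_on {i..j} (<) (>) (\<lambda>k. w ! k))"

text \<open>
  An alternating run is represented by its pair of (0-based) end positions \<open>(i, j)\<close>. Since
  \<open>i < j\<close>, it has at least two entries. Maximality is with respect to containment of the
  intervals \<open>{i..j}\<close>.
\<close>

definition alternating_runs :: "nat list \<Rightarrow> (nat \<times> nat) set" where
  "alternating_runs w =
     {(i, j). monotone_segment w i j \<and>
        (\<forall>i' j'. monotone_segment w i' j' \<and> {i..j} \<subseteq> {i'..j'} \<longrightarrow> i' = i \<and> j' = j)}"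

definition run :: "nat list \<Rightarrow> nat" where
  "run w = card (alternating_runs w)"

definition perm_word :: "nat \<Rightarrow> (nat \<Rightarrow> nat) \<Rightarrow> nat list" where
  "perm_word n \<pi> = map \<pi> [1..<n + 1]"

abbreviation X :: "int poly" where
  "X \<equiv> [:0, 1:]"

definition R :: "nat \<Rightarrow> int poly" where
  "R n = (\<Sum>\<pi> | \<pi> permutes {1..n}. X ^ run (perm_word n \<pi>))"

definition S :: "nat \<Rightarrow> int poly" where
  "S n = (\<Sum>\<pi> | \<pi> permutes {1..n}. X ^ run (0 # perm_word n \<pi>))"

end

theory Submission
  imports Defs "HOL-Combinatorics.Multiset_Permutations" "HOL-Library.Infinite_Set"
begin

text \<open>
  Cutting a word at its largest or smallest letter splits its alternating runs into those of the two
  pieces, provided that the pieces remember the letters next to them. This turns the counts into a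
  small system of differential equations for exponential generating functions. Let \<open>F\<close> be the series
  of \<open>S n\<close> (words with a small letter in front), \<open>T\<close> the series of words between a small letter in
  front and a large one behind, and \<open>V\<close> the series of words between two large letters, with constant
  term \<open>1\<close>. Then \<open>F' = F T\<close>, \<open>T' = T V\<close> and \<open>V' = T\<^sup>2\<close>, with values \<open>1\<close>, \<open>x\<close>, \<open>1\<close> at zero, and the
  series of \<open>R (n + 1)\<close> is \<open>F\<^sup>2\<close>, because a permutation without borders is cut at its maximum into
  two words that have a single border.

  Both recurrences come from one solution of this system. The series \<open>V\<^sup>2 - T\<^sup>2\<close> is constant, equal to
  \<open>u = 1 - x\<^sup>2\<close>, and hence \<open>T G = x\<close> for the series \<open>G\<close> with \<open>G'' = u G\<close>, \<open>G(0) = 1\<close>, \<open>G'(0) = -1\<close>;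
  its coefficients are \<open>(-1)\<^sup>n u\<^bsup>n div 2\<^esup>\<close>. Multiplying \<open>F' = F T\<close> and \<open>(F\<^sup>2)' = 2 F\<^sup>2 T\<close> by \<open>G\<close> gives
  \<open>F' G = x F\<close> and \<open>(F\<^sup>2)' G = 2 x F\<^sup>2\<close>, and comparing coefficients gives the recurrences
  (\<open>convolution_recurrence\<close>).

  Divisibility is read off the system, not off the recurrences: with \<open>A = V + T\<close> and \<open>B = V - T\<close>, which
  take the values \<open>1 + x\<close> and \<open>1 - x\<close> at zero, twice the derivative of
  \<open>F\<^sup>c A\<^sup>k B\<^sup>l\<close> is \<open>c + k - l\<close> times \<open>F\<^sup>c A\<^sup>k B\<^sup>l (A - B)\<close>. The factor \<open>c + k - l\<close> vanishes before
  the exponent of \<open>B\<close> can exceed \<open>c + k\<close>, so that at least about half of the factors that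
  accumulate under repeated differentiation of \<open>F\<^sup>c\<close> are copies of \<open>A\<close> (\<open>linear_power_dvd_hnth_power\<close>).

  The coefficients are integer polynomials, which cannot be divided by factorials. The series are
  therefore Hurwitz series: sequences multiplied by binomial convolution, with the shift as
  derivation.
\<close>

section \<open>Hurwitz series\<close>

typedef 'a hurwitz = "UNIV :: (nat \<Rightarrow> 'a) set"
  morphisms hnth Hurwitz ..

lemma hnth_Hurwitz [simp]: "hnth (Hurwitz f) n = f n"
  by (simp add: Hurwitz_inverse)

lemma hurwitz_eqI: "(\<And>n. hnth f n = hnth g n) \<Longrightarrow> f = g"
  by (metis ext hnth_inject)

definition hderiv :: "'a hurwitz \<Rightarrow> 'a hurwitz" where
  "hderiv f = Hurwitz (\<lambda>n. hnth f (Suc n))"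

lemma hnth_hderiv [simp]: "hnth (hderiv f) n = hnth f (Suc n)"
  by (simp add: hderiv_def)

instantiation hurwitz :: (comm_ring_1) comm_ring_1
begin

definition "0 = Hurwitz (\<lambda>_. 0)"
definition "1 = Hurwitz (\<lambda>n. if n = 0 then 1 else 0)"
definition "f + g = Hurwitz (\<lambda>n. hnth f n + hnth g n)"
definition "f - g = Hurwitz (\<lambda>n. hnth f n - hnth g n)"
definition "- f = Hurwitz (\<lambda>n. - hnth f n)"
definition "f * g = Hurwitz (\<lambda>n. \<Sum>k\<le>n. of_nat (n choose k) * hnth f k * hnth g (n - k))"

lemma hnth_arith:
  "hnth (0 :: 'a hurwitz) n = 0"
  "hnth (1 :: 'a hurwitz) n = (if n = 0 then 1 else 0)"
  "hnth (f + g :: 'a hurwitz) n = hnth f n + hnth g n"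
  "hnth (f - g :: 'a hurwitz) n = hnth f n - hnth g n"
  "hnth (- f :: 'a hurwitz) n = - hnth f n"
  by (simp_all add: zero_hurwitz_def one_hurwitz_def plus_hurwitz_def minus_hurwitz_def
      uminus_hurwitz_def)

lemma hnth_mult:
  "hnth (f * g :: 'a hurwitz) n = (\<Sum>k\<le>n. of_nat (n choose k) * hnth f k * hnth g (n - k))"
  by (simp add: times_hurwitz_def)

lemma hnth_mult_0: "hnth (f * g :: 'a hurwitz) 0 = hnth f 0 * hnth g 0"
  by (simp add: hnth_mult)

text \<open>
  The Leibniz rule is Pascal's rule. Together with the value at index \<open>0\<close> it determines the
  product recursively, so that the ring laws follow from it by induction on the index.
\<close>

lemma hnth_mult_Suc:
  "hnth (f * g :: 'a hurwitz) (Suc n) = hnth (hderiv f * g) n + hnth (f * hderiv g) n"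
proof -
  let ?f = "hnth f" and ?g = "hnth g"
  have "hnth (f * hderiv g) n = (\<Sum>k\<le>n. of_nat (n choose k) * ?f k * ?g (Suc n - k))"
    by (simp add: hnth_mult Suc_diff_le)
  also have "\<dots> = (\<Sum>k\<le>Suc n. of_nat (n choose k) * ?f k * ?g (Suc n - k))"
    by (simp add: binomial_eq_0)
  also have "\<dots> = ?f 0 * ?g (Suc n) + (\<Sum>k\<le>n. of_nat (n choose Suc k) * ?f (Suc k) * ?g (n - k))"
    by (subst sum.atMost_Suc_shift) simp
  finally have right: "hnth (f * hderiv g) n =
    ?f 0 * ?g (Suc n) + (\<Sum>k\<le>n. of_nat (n choose Suc k) * ?f (Suc k) * ?g (n - k))" .
  have "hnth (f * g) (Suc n) =
    ?f 0 * ?g (Suc n) + (\<Sum>k\<le>n. of_nat (Suc n choose Suc k) * ?f (Suc k) * ?g (n - k))"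
    unfolding hnth_mult by (subst sum.atMost_Suc_shift) simp
  also have "\<dots> = hnth (hderiv f * g) n + hnth (f * hderiv g) n"
    unfolding right by (simp add: hnth_mult algebra_simps sum.distrib)
  finally show ?thesis .
qed

lemma hnth_mult_add:
  "hnth ((f + g) * h :: 'a hurwitz) n = hnth (f * h) n + hnth (g * h) n"
  "hnth (h * (f + g) :: 'a hurwitz) n = hnth (h * f) n + hnth (h * g) n"
  by (simp_all add: hnth_mult hnth_arith algebra_simps sum.distrib)

lemma hderiv_mult: "hderiv (f * g :: 'a hurwitz) = hderiv f * g + f * hderiv g"
  by (rule hurwitz_eqI) (simp add: hnth_mult_Suc hnth_arith)

instance
proof
  fix a b c :: "'a hurwitz"
  show "a + b + c = a + (b + c)" "a + b = b + a" "0 + a = a" "- a + a = 0" "a - b = a + - b"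
    by (rule hurwitz_eqI, simp add: hnth_arith algebra_simps)+
  show "(0 :: 'a hurwitz) \<noteq> 1"
    by (metis hnth_arith(1,2) zero_neq_one)
  show "(a + b) * c = a * c + b * c"
    by (rule hurwitz_eqI) (simp add: hnth_mult_add hnth_arith)
  have "hnth (a * b) n = hnth (b * a) n" for n
    by (induction n arbitrary: a b) (simp_all add: hnth_mult_0 hnth_mult_Suc mult.commute)
  then show "a * b = b * a"
    by (rule hurwitz_eqI)
  have "hnth (a * b * c) n = hnth (a * (b * c)) n" for n
    by (induction n arbitrary: a b c)
       (simp_all add: hnth_mult_0 hnth_mult_Suc hderiv_mult hnth_mult_add mult.assoc)
  then show "a * b * c = a * (b * c)"
    by (rule hurwitz_eqI)
  have "hnth (1 * a) n = hnth a n" for n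
  proof -
    have "hnth (1 * a) n = (\<Sum>k\<in>{0}. of_nat (n choose k) * hnth 1 k * hnth a (n - k))"
      unfolding hnth_mult by (rule sum.mono_neutral_right) (auto simp: hnth_arith)
    then show ?thesis
      by (simp add: hnth_arith)
  qed
  then show "1 * a = a"
    by (rule hurwitz_eqI)
qed

end

lemma hderiv_arith:
  fixes f g :: "'a :: comm_ring_1 hurwitz"
  shows "hderiv (0 :: 'a hurwitz) = 0" "hderiv (1 :: 'a hurwitz) = 0"
    "hderiv (f + g) = hderiv f + hderiv g" "hderiv (f - g) = hderiv f - hderiv g"
    "hderiv (- f) = - hderiv f"
  by (rule hurwitz_eqI, simp add: hnth_arith)+

definition hconst :: "'a \<Rightarrow> 'a :: comm_ring_1 hurwitz" where
  "hconst c = Hurwitz (\<lambda>n. if n = 0 then c else 0)"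

lemma hderiv_hconst [simp]: "hderiv (hconst c) = 0"
  by (rule hurwitz_eqI) (simp add: hconst_def hnth_arith)

lemma hnth_hconst_0 [simp]: "hnth (hconst c) 0 = c"
  by (simp add: hconst_def)

lemma hnth_hconst_mult [simp]: "hnth (hconst c * f) n = c * hnth f n"
proof -
  have "hnth (hconst c * f) n =
    (\<Sum>k\<in>{0}. of_nat (n choose k) * hnth (hconst c) k * hnth f (n - k))"
    unfolding hnth_mult by (rule sum.mono_neutral_right) (auto simp: hconst_def)
  then show ?thesis
    by simp
qed

lemma hderiv_eq_0_imp_hconst:
  assumes "hderiv f = 0"
  shows "f = hconst (hnth f 0)"
proof (rule hurwitz_eqI)
  fix n
  have "hnth f (Suc k) = 0" for k
    using arg_cong[OF assms, of "\<lambda>g. hnth g k"] by (simp add: hnth_arith)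
  then show "hnth f n = hnth (hconst (hnth f 0)) n"
    by (cases n) (simp_all add: hconst_def)
qed

lemma hnth_of_nat_mult [simp]: "hnth (of_nat k * f) n = of_nat k * hnth f n"
  by (induction k) (simp_all add: algebra_simps hnth_arith)

lemma hnth_of_int_mult [simp]: "hnth (of_int k * f) n = of_int k * hnth f n"
  by (cases k) (simp_all add: hnth_arith del: of_nat_Suc)

lemma hnth_power_0: "hnth (f ^ k) 0 = hnth f 0 ^ k"
  by (induction k) (simp_all add: hnth_mult_0 hnth_arith)

lemma hderiv_power_of_log_deriv:
  fixes f g :: "'a :: comm_ring_1 hurwitz"
  assumes "hderiv f = f * g"
  shows "hderiv (f ^ k) = of_nat k * f ^ k * g"
  by (induction k) (simp_all add: hderiv_arith hderiv_mult assms algebra_simps)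


section \<open>The differential system\<close>

text \<open>
  This is \<open>cosh (z \<surd>u) - sinh (z \<surd>u) / \<surd>u\<close>, written without the square root.
\<close>

definition cosh_minus_sinh :: "'a :: comm_ring_1 \<Rightarrow> 'a hurwitz" where
  "cosh_minus_sinh u = Hurwitz (\<lambda>n. (- 1) ^ n * u ^ (n div 2))"

lemma hderiv2_cosh_minus_sinh:
  "hderiv (hderiv (cosh_minus_sinh u)) = hconst u * cosh_minus_sinh u"
  by (rule hurwitz_eqI) (simp add: cosh_minus_sinh_def)

text \<open>
  The logarithmic derivative \<open>V\<close> of \<open>T\<close> satisfies a Riccati equation, since \<open>T\<^sup>2\<close> and \<open>V\<^sup>2\<close> differ by the
  constant \<open>1 - x\<^sup>2\<close>. As usual for such an equation, \<open>V = - G' / G\<close> for a solution \<open>G\<close> of a linear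
  equation of order two, and then \<open>T G\<close> has derivative zero.
\<close>

lemma peak_series_times_cosh_minus_sinh:
  fixes T V :: "'a :: comm_ring_1 hurwitz"
  assumes T': "hderiv T = T * V" and V': "hderiv V = T * T"
    and T0: "hnth T 0 = x" and V0: "hnth V 0 = 1"
  shows "T * cosh_minus_sinh (1 - x ^ 2) = hconst x"
proof -
  have "hderiv (V * V - T * T) = 0"
    by (simp add: hderiv_arith hderiv_mult T' V' algebra_simps)
  from hderiv_eq_0_imp_hconst[OF this]
  have u: "V * V - T * T = hconst (1 - x ^ 2)"
    by (simp add: hnth_arith hnth_mult_0 T0 V0 power2_eq_square)
  define G where "G = cosh_minus_sinh (1 - x ^ 2)"
  define E where "E = hderiv G + V * G"
  have E': "hderiv E = V * E"
  proof -
    have "hderiv E = (V * V - T * T) * G + T * T * G + V * hderiv G"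
      unfolding E_def u
      by (simp add: hderiv_arith hderiv_mult V' G_def hderiv2_cosh_minus_sinh algebra_simps)
    then show ?thesis
      by (simp add: E_def algebra_simps)
  qed
  \<comment> \<open>\<open>E\<close> solves a homogeneous linear equation of order one with initial value \<open>-1 + 1 = 0\<close>.\<close>
  have "hnth E n = 0" for n
  proof (induction n rule: less_induct)
    case (less n)
    show ?case
    proof (cases n)
      case 0
      then show ?thesis
        by (simp add: E_def G_def hnth_arith hnth_mult_0 V0 cosh_minus_sinh_def)
    next
      case (Suc m)
      have "hnth E (Suc m) = hnth (V * E) m"
        by (simp flip: E')
      also have "\<dots> = 0"
        unfolding hnth_mult using less Suc by (intro sum.neutral) auto
      finally show ?thesis
        using Suc by simp
    qed
  qed
  then have "E = 0"
    by (intro hurwitz_eqI) (simp add: hnth_arith)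
  moreover have "hderiv (T * G) = T * E"
    by (simp add: hderiv_mult T' E_def algebra_simps)
  ultimately have "hderiv (T * G) = 0"
    by simp
  from hderiv_eq_0_imp_hconst[OF this]
  show "T * cosh_minus_sinh (1 - x ^ 2) = hconst x"
    by (simp add: G_def hnth_mult_0 T0 cosh_minus_sinh_def)
qed

text \<open>
  The coefficient at \<open>n\<close> of \<open>f' G = c x f\<close>, solved for the term in which \<open>f\<close> has the largest index.
\<close>

lemma convolution_recurrence:
  fixes f T :: "'a :: comm_ring_1 hurwitz"
  assumes f': "hderiv f = of_nat c * f * T"
    and TG: "T * cosh_minus_sinh u = hconst x"
  shows "hnth f (Suc n) = of_nat c * x * hnth f n
    - (\<Sum>k<n. of_nat (n choose k) * (- 1) ^ (n - k) * u ^ ((n - k) div 2) * hnth f (Suc k))"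
proof -
  let ?G = "cosh_minus_sinh u"
  have "hderiv f * ?G = hconst x * (of_nat c * f)"
    using TG unfolding f' by (metis mult.assoc mult.commute)
  moreover have "hnth (hconst x * (of_nat c * f)) n = of_nat c * x * hnth f n"
    by (simp add: mult.left_commute mult.assoc)
  ultimately have "of_nat c * x * hnth f n
      = (\<Sum>k\<le>n. of_nat (n choose k) * hnth f (Suc k) * hnth ?G (n - k))"
    by (metis (no_types, lifting) hnth_hderiv hnth_mult sum.cong)
  also have "\<dots> = (\<Sum>k<n. of_nat (n choose k) * hnth f (Suc k) * hnth ?G (n - k)) + hnth f (Suc n)"
    by (simp add: lessThan_Suc_atMost[symmetric] cosh_minus_sinh_def)
  also have "(\<Sum>k<n. of_nat (n choose k) * hnth f (Suc k) * hnth ?G (n - k))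
      = (\<Sum>k<n. of_nat (n choose k) * (- 1) ^ (n - k) * u ^ ((n - k) div 2) * hnth f (Suc k))"
    by (rule sum.cong) (simp_all add: cosh_minus_sinh_def mult_ac)
  finally show ?thesis
    by simp
qed

text \<open>
  The value at \<open>-1\<close> decides whether \<open>1 + X\<close> is a divisor, and a factor \<open>2\<close> cannot change whether it is
  zero. This undoes the scaling by powers of two in the next lemma.
\<close>

lemma linear_power_dvd_cancel_power_2:
  fixes p :: "int poly"
  assumes "(1 + X) ^ m dvd 2 ^ n * p"
  shows "(1 + X) ^ m dvd p"
  using assms
proof (induction m arbitrary: p)
  case (Suc m)
  have root: "(1 + X) dvd q \<longleftrightarrow> poly q (- 1) = 0" for q :: "int poly"
    using poly_eq_0_iff_dvd[of q "- 1"] by (simp add: one_pCons)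
  have nonzero: "1 + X \<noteq> (0 :: int poly)"
    by (simp add: one_pCons)
  have "(1 + X) dvd 2 ^ n * p"
    using Suc.prems by (rule dvd_trans[rotated]) simp
  then have "(1 + X) dvd p"
    unfolding root by simp
  then obtain q where q: "p = (1 + X) * q" ..
  have "(1 + X) ^ m dvd 2 ^ n * q"
    using Suc.prems nonzero unfolding q by (simp add: mult.left_commute)
  then have "(1 + X) ^ m dvd q"
    by (rule Suc.IH)
  then show ?case
    unfolding q by simp
qed simp

text \<open>
  The monomials \<open>M k l = f\<^sup>c A\<^sup>k B\<^sup>l\<close> satisfy \<open>2 M' = (c + k - l) (A - B) M\<close>. If \<open>l \<le> c + k\<close>, then either
  the derivative vanishes or both monomials in it satisfy the same inequality again. After \<open>n\<close>
  derivations only monomials with \<open>l' \<le> c + k'\<close> and \<open>k' + l' = n + k + l\<close> are left, hence with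
  \<open>k' \<ge> (n + k + l - c) / 2\<close>, and the value of such a monomial at zero is divisible by \<open>(1 + X)\<^bsup>k'\<^esup>\<close>. The
  factor \<open>2\<close> comes from \<open>T = (A - B) / 2\<close>.
\<close>

lemma linear_power_dvd_hnth_power:
  fixes f T V :: "int poly hurwitz"
  assumes f': "hderiv f = f * T" and T': "hderiv T = T * V" and V': "hderiv V = T * T"
    and T0: "hnth T 0 = X" and V0: "hnth V 0 = 1"
  shows "(1 + X) ^ ((n + 1 - c) div 2) dvd hnth (f ^ c) n"
proof -
  define A B where "A = V + T" and "B = V - T"
  have A': "hderiv A = A * T" and B': "hderiv B = B * - T"
    by (simp_all add: A_def B_def hderiv_arith T' V' algebra_simps)
  define M where "M k l = f ^ c * A ^ k * B ^ l" for k l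
  have M': "2 * hderiv (M k l) = (of_nat (c + k) - of_nat l) * (M (Suc k) l - M k (Suc l))" for k l
  proof -
    have "hderiv (M k l) = (of_nat (c + k) - of_nat l) * M k l * T"
      unfolding M_def
      by (simp add: hderiv_mult hderiv_power_of_log_deriv[OF f']
          hderiv_power_of_log_deriv[OF A'] hderiv_power_of_log_deriv[OF B'] algebra_simps)
    then have "2 * hderiv (M k l) = (of_nat (c + k) - of_nat l) * (M k l * (2 * T))"
      by simp
    also have "2 * T = A - B"
      by (simp add: A_def B_def)
    also have "M k l * (A - B) = M (Suc k) l - M k (Suc l)"
      by (simp add: M_def algebra_simps)
    finally show ?thesis .
  qed
  have "(1 + X) ^ ((n + k + l + 1 - c) div 2) dvd 2 ^ n * hnth (M k l) n"
    if "l \<le> c + k" for n k l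
    using that
  proof (induction n arbitrary: k l)
    case 0
    have "(1 + X) ^ ((k + l + 1 - c) div 2) dvd (1 + X) ^ k"
      using 0 by (intro le_imp_power_dvd) linarith
    moreover have "hnth (M k l) 0 = (1 + X) ^ k * (hnth f 0 ^ c * hnth B 0 ^ l)"
      by (simp add: M_def A_def hnth_mult_0 hnth_power_0 hnth_arith T0 V0)
    ultimately show ?case
      by (simp add: dvd_mult2)
  next
    case (Suc n)
    show ?case
    proof (cases "l = c + k")
      case True
      then have "2 * hderiv (M k l) = 0"
        by (simp add: M')
      then have "hnth (hderiv (M k l) + hderiv (M k l)) n = 0"
        by (simp only: mult_2 hnth_arith)
      then have "hnth (M k l) (Suc n) = 0"
        by (simp only: hnth_arith hnth_hderiv)
      then show ?thesis
        by simp
    next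
      case False
      let ?c = "of_int (int (c + k) - int l) :: int poly"
      let ?d = "(1 + X) ^ ((Suc n + k + l + 1 - c) div 2) :: int poly"
      have "hnth (hderiv (M k l) + hderiv (M k l)) n = ?c * (hnth (M (Suc k) l) n - hnth (M k (Suc l)) n)"
      proof -
        have "hderiv (M k l) + hderiv (M k l) =
            of_int (int (c + k) - int l) * (M (Suc k) l - M k (Suc l))"
          using M'[of k l] by (simp flip: mult_2)
        then show ?thesis
          by (simp only: hnth_of_int_mult hnth_arith)
      qed
      then have double: "hnth (M k l) (Suc n) + hnth (M k l) (Suc n) =
          ?c * (hnth (M (Suc k) l) n - hnth (M k (Suc l)) n)"
        by (simp only: hnth_arith hnth_hderiv)
      have "2 ^ Suc n * hnth (M k l) (Suc n) = 2 ^ n * (hnth (M k l) (Suc n) + hnth (M k l) (Suc n))"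
        by simp
      then have "2 ^ Suc n * hnth (M k l) (Suc n) =
          ?c * (2 ^ n * hnth (M (Suc k) l) n - 2 ^ n * hnth (M k (Suc l)) n)"
        unfolding double by (simp only: right_diff_distrib mult.left_commute)
      moreover have "?d dvd 2 ^ n * hnth (M (Suc k) l) n" "?d dvd 2 ^ n * hnth (M k (Suc l)) n"
        using Suc.IH[of l "Suc k"] Suc.IH[of "Suc l" k] Suc.prems False by simp_all
      ultimately show ?thesis
        by simp
    qed
  qed
  from this[of 0 0 n] have "(1 + X) ^ ((n + 1 - c) div 2) dvd 2 ^ n * hnth (f ^ c) n"
    by (simp add: M_def)
  then show ?thesis
    by (rule linear_power_dvd_cancel_power_2)
qed


section \<open>Words, ascents and runs\<close>

fun ascents :: "nat list \<Rightarrow> bool list" where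
  "ascents (a # b # w) = (a < b) # ascents (b # w)"
| "ascents w = []"

text \<open>
  Alternating runs are the maximal constant blocks of the ascent word. A neighbouring letter that is
  smaller or larger than all the others contributes just one more bit, at its end of the ascent word.
\<close>

abbreviation blocks :: "bool list \<Rightarrow> nat" where
  "blocks bs \<equiv> length (remdups_adj bs)"

lemma length_ascents [simp]: "length (ascents w) = length w - 1"
  by (induction w rule: ascents.induct) auto

lemma nth_ascents: "Suc i < length w \<Longrightarrow> ascents w ! i \<longleftrightarrow> w ! i < w ! Suc i"
  by (induction w arbitrary: i rule: ascents.induct) (auto simp: nth_Cons split: nat.split)

lemma ascents_append: "ascents (u @ m # v) = ascents (u @ [m]) @ ascents (m # v)"
  by (induction u rule: ascents.induct) auto

lemma ascents_snoc: "u \<noteq> [] \<Longrightarrow> ascents (u @ [m]) = ascents u @ [last u < m]"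
  by (induction u rule: ascents.induct) auto

lemma ascents_Cons: "v \<noteq> [] \<Longrightarrow> ascents (m # v) = (m < hd v) # ascents v"
  by (cases v) auto

lemma ascents_map_strict_mono:
  "strict_mono_on (set w) f \<Longrightarrow> ascents (map f w) = ascents w"
  by (intro nth_equalityI) (auto simp: nth_ascents strict_mono_on_less)

lemma ascents_map_strict_antimono:
  assumes "strict_antimono_on (set w) f" "distinct w"
  shows "ascents (map f w) = map Not (ascents w)"
proof (rule nth_equalityI)
  fix i assume "i < length (ascents (map f w))"
  then have i: "Suc i < length w"
    by simp
  have "w ! i \<noteq> w ! Suc i"
    using i assms(2) by (simp add: nth_eq_iff_index_eq)
  then have "f (w ! i) < f (w ! Suc i) \<longleftrightarrow> \<not> w ! i < w ! Suc i"
    using i monotone_onD[OF assms(1), of "w ! i" "w ! Suc i"]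
      monotone_onD[OF assms(1), of "w ! Suc i" "w ! i"] by auto
  then show "ascents (map f w) ! i = map Not (ascents w) ! i"
    using i by (simp add: nth_ascents)
qed simp

lemma ascents_rev: "distinct w \<Longrightarrow> ascents (rev w) = rev (map Not (ascents w))"
proof (induction w rule: ascents.induct)
  case (1 a b w)
  then show ?case
    using ascents_append[of "rev w" b "[a]"] by auto
qed auto

lemma blocks_snoc:
  "blocks (bs @ [b]) = blocks bs + (if bs \<noteq> [] \<and> last bs = b then 0 else 1)"
  by (cases bs rule: rev_cases) (auto simp: remdups_adj_append_two)

lemma blocks_append_neq: "blocks (p @ [\<not> b] @ b # q) = blocks (p @ [\<not> b]) + blocks (b # q)"
  using remdups_adj_append[of p "\<not> b" "b # q"]
  by (simp add: remdups_adj_Cons[of _ "b # q"] split: list.split)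

lemma blocks_map_Not [simp]: "blocks (map Not bs) = blocks bs"
  by (simp add: remdups_adj_map_injective inj_def)

lemma blocks_eq_card:
  "blocks bs = card {i. i < length bs \<and> (i = 0 \<or> bs ! (i - 1) \<noteq> bs ! i)}"
proof (induction bs rule: rev_induct)
  case (snoc b bs)
  let ?C = "\<lambda>bs. {i. i < length bs \<and> (i = 0 \<or> bs ! (i - 1) \<noteq> bs ! i)}"
  have "?C (bs @ [b]) = ?C bs \<union> (if bs \<noteq> [] \<and> last bs = b then {} else {length bs})"
    by (cases bs rule: rev_cases) (auto simp: nth_append less_Suc_eq split: if_splits)
  then show ?case
    by (simp add: blocks_snoc snoc.IH)
qed simp

lemma monotone_segment_iff:
  "monotone_segment w i j \<longleftrightarrow> i < j \<and> j < length w \<and>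
    ((\<forall>k\<in>{i..<j}. w ! k < w ! Suc k) \<or> (\<forall>k\<in>{i..<j}. w ! k > w ! Suc k))"
proof -
  have mono: "monotone_on {i..j} (<) r (\<lambda>k. w ! k) \<longleftrightarrow> (\<forall>k\<in>{i..<j}. r (w ! k) (w ! Suc k))"
    if "transp r" for r :: "nat \<Rightarrow> nat \<Rightarrow> bool"
  proof
    assume step: "\<forall>k\<in>{i..<j}. r (w ! k) (w ! Suc k)"
    show "monotone_on {i..j} (<) r (\<lambda>k. w ! k)"
    proof (rule monotone_onI)
      fix a b assume "a \<in> {i..j}" "b \<in> {i..j}" "a < b"
      then have "Suc a \<le> b" "i \<le> a" "b \<le> j" by auto
      then show "r (w ! a) (w ! b)"
      proof (induction b rule: dec_induct)
        case base
        then show ?case using step by auto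
      next
        case (step b)
        then have "r (w ! a) (w ! b)" "r (w ! b) (w ! Suc b)"
          using \<open>\<forall>k\<in>{i..<j}. r (w ! k) (w ! Suc k)\<close> by auto
        then show ?case using that by (rule transpD[rotated])
      qed
    qed
  qed (auto simp: monotone_on_def)
  show ?thesis
    unfolding monotone_segment_def by (subst (1 2) mono) (auto simp: transp_def)
qed

text \<open>
  Mapping a run to its starting position is injective, by maximality, and its image consists of the
  positions at which a block of the ascent word begins.
\<close>

lemma run_eq_blocks:
  assumes "distinct w"
  shows "run w = blocks (ascents w)"
proof -
  have nth: "(w ! k < w ! Suc k) = ascents w ! k" "(w ! k > w ! Suc k) = (\<not> ascents w ! k)"
    if "j < length w" "k \<in> {i..<j}" for i j k
    using that assms nth_eq_iff_index_eq[of w k "Suc k"] nth_ascents[of k w] by auto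
  have seg: "monotone_segment w i j \<longleftrightarrow> i < j \<and> j < length w \<and>
      ((\<forall>k\<in>{i..<j}. ascents w ! k) \<or> (\<forall>k\<in>{i..<j}. \<not> ascents w ! k))" for i j
    unfolding monotone_segment_iff using nth by (metis (no_types, lifting))
  have segI: "monotone_segment w i j"
    if "i < j" "j < length w" "\<And>k. i \<le> k \<Longrightarrow> k < j \<Longrightarrow> ascents w ! k = b" for i j b
    unfolding seg using that by (cases b) auto
  have segD: "i < j" "j < length w"
    "\<And>k l. i \<le> k \<Longrightarrow> k < j \<Longrightarrow> i \<le> l \<Longrightarrow> l < j \<Longrightarrow> ascents w ! k = ascents w ! l"
    if "monotone_segment w i j" for i j
    using that unfolding seg by auto
  let ?C = "{i. i < length (ascents w) \<and> (i = 0 \<or> ascents w ! (i - 1) \<noteq> ascents w ! i)}"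
  have "inj_on fst (alternating_runs w)"
  proof (rule inj_onI, clarsimp)
    fix i j j' assume *: "(i, j) \<in> alternating_runs w" "(i, j') \<in> alternating_runs w"
    have "{i..j} \<subseteq> {i..j'} \<or> {i..j'} \<subseteq> {i..j}" by auto
    with * show "j = j'"
      unfolding alternating_runs_def by blast
  qed
  moreover have "fst ` alternating_runs w = ?C"
  proof (intro equalityI subsetI)
    fix i assume "i \<in> fst ` alternating_runs w"
    then obtain j where "(i, j) \<in> alternating_runs w"
      by auto
    then have ij: "monotone_segment w i j"
      and max: "\<And>i' j'. monotone_segment w i' j' \<Longrightarrow> {i..j} \<subseteq> {i'..j'} \<Longrightarrow> i' = i"
      unfolding alternating_runs_def by blast+
    have "ascents w ! (i - 1) \<noteq> ascents w ! i" if "i \<noteq> 0"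
    proof
      assume eq: "ascents w ! (i - 1) = ascents w ! i"
      have const: "ascents w ! k = ascents w ! (i - 1)" if "i - 1 \<le> k" "k < j" for k
      proof (cases "k = i - 1")
        case False
        then show ?thesis
          unfolding eq using that segD(1)[OF ij] by (intro segD(3)[OF ij]) auto
      qed simp
      have "i - 1 < j"
        using segD(1)[OF ij] by simp
      then have "monotone_segment w (i - 1) j"
        using segD(2)[OF ij] const by (rule segI)
      from max[OF this] that show False by auto
    qed
    then show "i \<in> ?C"
      using segD(1,2)[OF ij] by auto
  next
    fix i assume i: "i \<in> ?C"
    define j where "j = Max {j. monotone_segment w i j}"
    have "finite {j. monotone_segment w i j}"
      by (rule finite_subset[of _ "{..<length w}"]) (auto dest: segD(2))
    moreover have "monotone_segment w i (Suc i)"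
      using i by (intro segI[of _ _ "ascents w ! i"]) (auto simp: le_less_Suc_eq)
    ultimately have j: "monotone_segment w i j" "\<And>j'. monotone_segment w i j' \<Longrightarrow> j' \<le> j"
      unfolding j_def using Max_in[of "{j. monotone_segment w i j}"] by auto
    have "i' = i \<and> j' = j" if ij': "monotone_segment w i' j'" "{i..j} \<subseteq> {i'..j'}" for i' j'
    proof -
      have le: "i' \<le> i" "j \<le> j'" "i < j"
        using ij' segD(1)[OF j(1)] by auto
      have "i' = i"
      proof (rule ccontr)
        assume "i' \<noteq> i"
        then have "ascents w ! (i - 1) = ascents w ! i"
          using le by (intro segD(3)[OF ij'(1)]) auto
        then show False
          using i le \<open>i' \<noteq> i\<close> by auto
      qed
      then show ?thesis
        using ij' j(2)[of j'] le by auto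
    qed
    then have "(i, j) \<in> alternating_runs w"
      unfolding alternating_runs_def using j(1) by blast
    then show "i \<in> fst ` alternating_runs w"
      by force
  qed
  ultimately show ?thesis
    using card_image[of fst "alternating_runs w"] by (simp add: run_def blocks_eq_card)
qed

section \<open>Sums over arrangements\<close>

text \<open>
  The length is part of the data because the empty word and the words of length one have the same
  ascent word, but carry different weights below.
\<close>

definition ascent_invariant :: "(nat list \<Rightarrow> 'a) \<Rightarrow> bool" where
  "ascent_invariant f \<longleftrightarrow>
    (\<forall>v w. length v = length w \<longrightarrow> ascents v = ascents w \<longrightarrow> f v = f w)"

definition arr_sum :: "(nat list \<Rightarrow> 'a :: comm_ring_1) \<Rightarrow> nat \<Rightarrow> 'a" where
  "arr_sum f n = (\<Sum>w\<in>permutations_of_set {..<n}. f w)"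

lemma sum_permutations_of_set_image:
  assumes "inj_on c A"
  shows "(\<Sum>w\<in>permutations_of_set (c ` A). f w) = (\<Sum>w\<in>permutations_of_set A. f (map c w))"
proof -
  have "inj_on (map c) (permutations_of_set A)"
    by (rule inj_onI) (metis assms map_inj_on permutations_of_setD(1) sup.idem)
  then show ?thesis
    unfolding permutations_of_set_image_inj[OF assms] by (simp add: sum.reindex)
qed

lemma sum_permutations_of_set_invariant:
  assumes "finite A" "ascent_invariant f"
  shows "(\<Sum>w\<in>permutations_of_set A. f w) = arr_sum f (card A)"
proof -
  obtain h where h: "bij_betw h {..<card A} A" "strict_mono_on {..<card A} h"
    using ex_bij_betw_strict_mono_card[OF assms(1)] by blast
  have "(\<Sum>w\<in>permutations_of_set A. f w) = (\<Sum>w\<in>permutations_of_set {..<card A}. f (map h w))"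
    using sum_permutations_of_set_image[of h "{..<card A}" f] h(1)
    by (simp add: bij_betw_def)
  also have "\<dots> = arr_sum f (card A)"
    unfolding arr_sum_def
  proof (rule sum.cong)
    fix w assume "w \<in> permutations_of_set {..<card A}"
    then have "ascents (map h w) = ascents w"
      using h(2) by (intro ascents_map_strict_mono)
        (simp add: permutations_of_setD)
    then show "f (map h w) = f w"
      using assms(2) unfolding ascent_invariant_def by (metis length_map)
  qed simp
  finally show ?thesis .
qed

lemma arr_sum_complement:
  assumes "\<And>v w. length v = length w \<Longrightarrow> ascents v = map Not (ascents w) \<Longrightarrow> f v = g w"
  shows "arr_sum f n = arr_sum g n"
proof -
  let ?c = "\<lambda>i. n - Suc i"
  have inj: "inj_on ?c {..<n}"
    by (auto simp: inj_on_def)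
  have image: "?c ` {..<n} = {..<n}"
    by (rule endo_inj_surj[OF _ _ inj]) auto
  have "arr_sum f n = (\<Sum>w\<in>permutations_of_set {..<n}. f (map ?c w))"
    using sum_permutations_of_set_image[OF inj, of f] unfolding image arr_sum_def .
  also have "\<dots> = arr_sum g n"
    unfolding arr_sum_def
  proof (rule sum.cong)
    fix w assume w: "w \<in> permutations_of_set {..<n}"
    have "strict_antimono_on {..<n} ?c"
      by (rule monotone_onI) simp
    then have "ascents (map ?c w) = map Not (ascents w)"
      using permutations_of_setD[OF w] by (intro ascents_map_strict_antimono) simp_all
    then show "f (map ?c w) = g w"
      by (intro assms) simp
  qed simp
  finally show ?thesis .
qed

lemma arr_sum_reverse:
  assumes "\<And>v w. length v = length w \<Longrightarrow> ascents v = rev (map Not (ascents w)) \<Longrightarrow> f v = g w"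
  shows "arr_sum f n = arr_sum g n"
proof -
  have "arr_sum f n = (\<Sum>w\<in>rev ` permutations_of_set {..<n}. f w)"
    by (simp add: arr_sum_def)
  also have "\<dots> = (\<Sum>w\<in>permutations_of_set {..<n}. f (rev w))"
    by (subst sum.reindex) (simp_all add: inj_on_def o_def)
  also have "\<dots> = arr_sum g n"
    unfolding arr_sum_def
    by (intro sum.cong refl assms ascents_rev length_rev) (rule permutations_of_setD(2))
  finally show ?thesis .
qed

lemma sum_Pow_card:
  assumes "finite A"
  shows "(\<Sum>B\<in>Pow A. f (card B)) = (\<Sum>k\<le>card A. of_nat (card A choose k) * f k)"
proof -
  have "(\<Sum>B\<in>Pow A. f (card B)) = (\<Sum>k\<le>card A. \<Sum>B | B \<in> Pow A \<and> card B = k. f (card B))"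
    using assms by (intro sum.group[symmetric]) (auto intro: card_mono)
  also have "\<dots> = (\<Sum>k\<le>card A. of_nat (card A choose k) * f k)"
    using assms by (intro sum.cong) (simp_all add: n_subsets)
  finally show ?thesis .
qed

text \<open>
  A word without repetitions is cut at the letter \<open>m\<close>; the set \<open>B\<close> collects the letters in front of \<open>m\<close>.
\<close>

lemma sum_permutations_of_set_split:
  fixes f :: "'a list \<Rightarrow> 'b :: comm_ring_1"
  assumes "finite A" "m \<in> A"
    and "\<And>u v. set u \<subseteq> A - {m} \<Longrightarrow> set v \<subseteq> A - {m} \<Longrightarrow> f (u @ m # v) = g u * h v"
  shows "(\<Sum>w\<in>permutations_of_set A. f w) =
    (\<Sum>B\<in>Pow (A - {m}). (\<Sum>u\<in>permutations_of_set B. g u)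
       * (\<Sum>v\<in>permutations_of_set (A - {m} - B). h v))"
proof -
  let ?D = "SIGMA B:Pow (A - {m}). permutations_of_set B \<times> permutations_of_set (A - {m} - B)"
  let ?j = "\<lambda>(B, u, v). u @ m # v"
  have "inj_on ?j ?D"
  proof (rule inj_onI, clarify)
    fix B u v B' u' v'
    assume *: "B \<subseteq> A - {m}" "B' \<subseteq> A - {m}" "u \<in> permutations_of_set B"
      "u' \<in> permutations_of_set B'" "v \<in> permutations_of_set (A - {m} - B)"
      "v' \<in> permutations_of_set (A - {m} - B')" "u @ m # v = u' @ m # v'"
    then have "m \<notin> set u" "m \<notin> set v"
      by (auto simp: permutations_of_set_def)
    with * have "u = u'" "v = v'"
      by (auto simp: append_Cons_eq_iff[of m u v u' v'] permutations_of_set_def)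
    with * show "B = B' \<and> (u, v) = (u', v')"
      by (auto simp: permutations_of_set_def)
  qed
  moreover have "?j ` ?D = permutations_of_set A"
  proof (intro equalityI subsetI)
    fix w assume w: "w \<in> permutations_of_set A"
    then obtain u v where uv: "w = u @ m # v"
      using assms(2) by (metis permutations_of_setD(1) split_list)
    have "(set u, u, v) \<in> ?D"
      using w unfolding uv by (auto simp: permutations_of_set_def)
    then show "w \<in> ?j ` ?D"
      unfolding uv by (metis (mono_tags, lifting) case_prod_conv image_eqI)
  qed (use assms(2) in \<open>auto simp: permutations_of_set_def\<close>)
  ultimately have "(\<Sum>w\<in>permutations_of_set A. f w) = (\<Sum>d\<in>?D. f (?j d))"
    by (metis (no_types, lifting) sum.reindex_cong)
  also have "\<dots> = (\<Sum>(B, u, v)\<in>?D. g u * h v)"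
    by (intro sum.cong) (auto intro!: assms(3) simp: permutations_of_set_def)
  also have "\<dots> = (\<Sum>B\<in>Pow (A - {m}).
      \<Sum>(u, v)\<in>permutations_of_set B \<times> permutations_of_set (A - {m} - B). g u * h v)"
    using assms(1) by (subst sum.Sigma[symmetric]) auto
  also have "\<dots> = (\<Sum>B\<in>Pow (A - {m}). (\<Sum>u\<in>permutations_of_set B. g u)
       * (\<Sum>v\<in>permutations_of_set (A - {m} - B). h v))"
    by (simp only: sum_product sum.cartesian_product)
  finally show ?thesis .
qed

text \<open>
  Since the sums over the two pieces depend only on the numbers of their letters, the choice of the
  letters contributes a binomial coefficient, and the result is the product of Hurwitz series.
\<close>

lemma arr_sum_Suc_split:
  assumes "m \<le> n" "ascent_invariant g" "ascent_invariant h"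
    and "\<And>u v. set u \<subseteq> {..n} - {m} \<Longrightarrow> set v \<subseteq> {..n} - {m} \<Longrightarrow> f (u @ m # v) = g u * h v"
  shows "arr_sum f (Suc n) = hnth (Hurwitz (arr_sum g) * Hurwitz (arr_sum h)) n"
proof -
  have card: "card ({..n} - {m}) = n"
    using assms(1) by simp
  have "arr_sum f (Suc n) = (\<Sum>B\<in>Pow ({..n} - {m}). (\<Sum>u\<in>permutations_of_set B. g u)
       * (\<Sum>v\<in>permutations_of_set ({..n} - {m} - B). h v))"
    unfolding arr_sum_def lessThan_Suc_atMost
    using assms(1,4) by (intro sum_permutations_of_set_split) auto
  also have "\<dots> = (\<Sum>B\<in>Pow ({..n} - {m}). arr_sum g (card B) * arr_sum h (n - card B))"
  proof (rule sum.cong)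
    fix B assume B: "B \<in> Pow ({..n} - {m})"
    then have "finite B"
      by (auto intro: finite_subset)
    then have "card ({..n} - {m} - B) = n - card B"
      using B card by (subst card_Diff_subset) auto
    then show "(\<Sum>u\<in>permutations_of_set B. g u) * (\<Sum>v\<in>permutations_of_set ({..n} - {m} - B). h v)
        = arr_sum g (card B) * arr_sum h (n - card B)"
      using \<open>finite B\<close> assms(2,3) by (simp add: sum_permutations_of_set_invariant)
  qed simp
  also have "\<dots> = hnth (Hurwitz (arr_sum g) * Hurwitz (arr_sum h)) n"
    using sum_Pow_card[of "{..n} - {m}" "\<lambda>k. arr_sum g k * arr_sum h (n - k)"] card
    by (simp add: hnth_mult mult.assoc)
  finally show ?thesis .
qed

definition egf :: "(nat list \<Rightarrow> 'a :: comm_ring_1) \<Rightarrow> 'a hurwitz" where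
  "egf f = Hurwitz (arr_sum f)"

lemma hnth_egf [simp]: "hnth (egf f) n = arr_sum f n"
  by (simp add: egf_def)

lemma arr_sum_0 [simp]: "arr_sum f 0 = f []"
  by (simp add: arr_sum_def)

lemma hderiv_egf_max:
  assumes "ascent_invariant g" "ascent_invariant h"
    and "\<And>u v m. \<forall>a\<in>set u \<union> set v. a < m \<Longrightarrow> f (u @ m # v) = g u * h v"
  shows "hderiv (egf f) = egf g * egf h"
proof (rule hurwitz_eqI)
  fix n
  have "f (u @ n # v) = g u * h v" if "set u \<subseteq> {..n} - {n}" "set v \<subseteq> {..n} - {n}" for u v
    using that by (intro assms(3)) force
  from arr_sum_Suc_split[OF order_refl assms(1,2) this]
  show "hnth (hderiv (egf f)) n = hnth (egf g * egf h) n"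
    by (simp add: egf_def)
qed

lemma hderiv_egf_min:
  assumes "ascent_invariant g" "ascent_invariant h"
    and "\<And>u v m. \<forall>a\<in>set u \<union> set v. m < a \<Longrightarrow> f (u @ m # v) = g u * h v"
  shows "hderiv (egf f) = egf g * egf h"
proof (rule hurwitz_eqI)
  fix n
  have "f (u @ 0 # v) = g u * h v" if "set u \<subseteq> {..n} - {0}" "set v \<subseteq> {..n} - {0}" for u v
    using that by (intro assms(3)) force
  from arr_sum_Suc_split[OF le0 assms(1,2) this]
  show "hnth (hderiv (egf f)) n = hnth (egf g * egf h) n"
    by (simp add: egf_def)
qed

section \<open>Weights with borders\<close>

text \<open>
  The weights record how many runs a word \<open>w\<close> has together with its borders: \<open>True\<close> in front stands for a
  smaller letter there and \<open>False\<close> for a larger one, while at the back \<open>True\<close> stands for a larger letter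
  and \<open>False\<close> for a smaller one. A border next to the empty word makes no run, so that three
  of the weights are \<open>1\<close> on the empty word. For \<open>cup_weight\<close> the same value says that a cut at the last
  letter, just before a larger border, starts no new run. For \<open>rise_weight\<close> and \<open>fall_weight\<close> the two
  borders of the empty word make a single run, as the two equal bits do.
\<close>

definition run_weight :: "nat list \<Rightarrow> int poly" where
  "run_weight w = X ^ blocks (ascents w)"

definition up_weight :: "nat list \<Rightarrow> int poly" where
  "up_weight w = (if w = [] then 1 else X ^ blocks (True # ascents w))"

definition down_weight :: "nat list \<Rightarrow> int poly" where
  "down_weight w = (if w = [] then 1 else X ^ blocks (False # ascents w))"

definition climb_weight :: "nat list \<Rightarrow> int poly" where
  "climb_weight w = (if w = [] then 1 else X ^ blocks (ascents w @ [True]))"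

definition rise_weight :: "nat list \<Rightarrow> int poly" where
  "rise_weight w = X ^ blocks (True # ascents w @ [True])"

definition fall_weight :: "nat list \<Rightarrow> int poly" where
  "fall_weight w = X ^ blocks (False # ascents w @ [False])"

definition cup_weight :: "nat list \<Rightarrow> int poly" where
  "cup_weight w = (if w = [] then 1 else X ^ blocks (False # ascents w @ [True]))"

lemmas weight_defs = run_weight_def up_weight_def down_weight_def climb_weight_def
  rise_weight_def fall_weight_def cup_weight_def

lemma ascent_invariantI:
  assumes "\<And>v w. v = [] \<longleftrightarrow> w = [] \<Longrightarrow> ascents v = ascents w \<Longrightarrow> f v = f w"
  shows "ascent_invariant f"
  unfolding ascent_invariant_def
proof (intro allI impI assms)
  fix v w :: "nat list" assume "length v = length w"
  then show "v = [] \<longleftrightarrow> w = []"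
    by (metis length_0_conv)
qed

lemma ascent_invariant_weights:
  "ascent_invariant down_weight" "ascent_invariant climb_weight" "ascent_invariant rise_weight"
  "ascent_invariant run_weight" "ascent_invariant up_weight"
  "ascent_invariant fall_weight" "ascent_invariant cup_weight"
  by (rule ascent_invariantI, simp add: weight_defs)+

lemma arr_sum_down_weight: "arr_sum down_weight = arr_sum up_weight"
proof (rule ext, rule arr_sum_complement)
  fix v w :: "nat list" assume "length v = length w" and v: "ascents v = map Not (ascents w)"
  then have "v = [] \<longleftrightarrow> w = []"
    by (metis length_0_conv)
  with v show "down_weight v = up_weight w"
    using blocks_map_Not[of "True # ascents w"] by (simp add: weight_defs del: blocks_map_Not)
qed

text \<open>
  Read backwards, a word with a large letter behind it becomes a word with a large letter in front, and
  complementation makes that letter a small one.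
\<close>

lemma arr_sum_climb_weight: "arr_sum climb_weight = arr_sum up_weight"
proof -
  have "arr_sum climb_weight = arr_sum down_weight"
  proof (rule ext, rule arr_sum_reverse)
    fix v w :: "nat list"
    assume "length v = length w" and v: "ascents v = rev (map Not (ascents w))"
    then have "v = [] \<longleftrightarrow> w = []"
      by (metis length_0_conv)
    with v show "climb_weight v = down_weight w"
      using blocks_map_Not[of "False # ascents w"]
        arg_cong[OF remdups_adj_rev[of "True # map Not (ascents w)"], of length]
      by (simp add: weight_defs del: blocks_map_Not)
  qed
  then show ?thesis
    by (simp add: arr_sum_down_weight)
qed

lemma arr_sum_fall_weight: "arr_sum fall_weight = arr_sum rise_weight"
proof (rule ext, rule arr_sum_complement)
  fix v w assume "length v = length w" "ascents v = map Not (ascents w)"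
  then show "fall_weight v = rise_weight w"
    using blocks_map_Not[of "True # ascents w @ [True]"]
    by (simp add: weight_defs del: blocks_map_Not)
qed

lemma ascents_split_max:
  assumes "\<forall>a\<in>set u \<union> set v. a < m"
  shows "ascents (u @ m # v) =
    (if u = [] then [] else ascents u @ [True]) @ (if v = [] then [] else False # ascents v)"
proof -
  have "last u < m" if "u \<noteq> []" using assms that by simp
  moreover have "\<not> m < hd v" if "v \<noteq> []"
    using assms hd_in_set[OF that] by (meson UnI2 order.asym)
  ultimately show ?thesis
    unfolding ascents_append[of u m v] by (simp add: ascents_snoc ascents_Cons)
qed

lemma ascents_split_min:
  assumes "\<forall>a\<in>set u \<union> set v. m < a"
  shows "ascents (u @ m # v) =
    (if u = [] then [] else ascents u @ [False]) @ (if v = [] then [] else True # ascents v)"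
proof -
  have "\<not> last u < m" if "u \<noteq> []"
    using assms last_in_set[OF that] by (meson UnI1 order.asym)
  moreover have "m < hd v" if "v \<noteq> []" using assms that by simp
  ultimately show ?thesis
    unfolding ascents_append[of u m v] by (simp add: ascents_snoc ascents_Cons)
qed

lemma blocks_turn:
  "blocks (p @ True # False # q) = blocks (p @ [True]) + blocks (False # q)"
  "blocks (p @ False # True # q) = blocks (p @ [False]) + blocks (True # q)"
  using blocks_append_neq[of p False q] blocks_append_neq[of p True q] by simp_all

lemma blocks_repeat: "blocks (p @ [b, b]) = blocks (p @ [b])"
  by (simp add: remdups_adj_append_two)

text \<open>
  In this and the next three identities the extreme letter at which a word is cut is a turn, which
  shows as a change of bit between the ascent words of the two pieces, unless one of the pieces is
  empty and has weight \<open>1\<close>. Reversal and complementation bring the pieces to the standard borders. The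
  words between two large letters are cut at their minimum, which is always a turn; their maximum need
  not be one, for next to a border it lies on a slope.
\<close>

lemma hderiv_egf_run_weight: "hderiv (egf run_weight) = egf up_weight * egf up_weight"
proof -
  have "hderiv (egf run_weight) = egf climb_weight * egf down_weight"
  proof (rule hderiv_egf_max)
    fix u v :: "nat list" and m assume "\<forall>a\<in>set u \<union> set v. a < m"
    from ascents_split_max[OF this]
    show "run_weight (u @ m # v) = climb_weight u * down_weight v"
      by (simp add: weight_defs blocks_turn power_add)
  qed (rule ascent_invariant_weights)+
  then show ?thesis
    by (simp add: egf_def arr_sum_climb_weight arr_sum_down_weight)
qed

lemma hderiv_egf_up_weight: "hderiv (egf up_weight) = egf up_weight * egf rise_weight"
proof -
  have "hderiv (egf up_weight) = egf rise_weight * egf down_weight"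
  proof (rule hderiv_egf_max)
    fix u v :: "nat list" and m assume "\<forall>a\<in>set u \<union> set v. a < m"
    from ascents_split_max[OF this]
    show "up_weight (u @ m # v) = rise_weight u * down_weight v"
      using blocks_turn(1)[of "True # ascents u" "ascents v"] blocks_turn(1)[of "[]" "ascents v"]
      by (simp add: weight_defs power_add)
  qed (rule ascent_invariant_weights)+
  then show ?thesis
    by (simp add: egf_def arr_sum_down_weight mult.commute)
qed

lemma hderiv_egf_rise_weight: "hderiv (egf rise_weight) = egf rise_weight * egf cup_weight"
proof (rule hderiv_egf_max)
  fix u v :: "nat list" and m assume "\<forall>a\<in>set u \<union> set v. a < m"
  from ascents_split_max[OF this]
  show "rise_weight (u @ m # v) = rise_weight u * cup_weight v"
    using blocks_turn(1)[of "True # ascents u" "ascents v @ [True]"]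
      blocks_turn(1)[of "[]" "ascents v @ [True]"] blocks_repeat[of "True # ascents u" True]
    by (simp add: weight_defs power_add)
qed (rule ascent_invariant_weights)+

lemma hderiv_egf_cup_weight: "hderiv (egf cup_weight) = egf rise_weight * egf rise_weight"
proof -
  have "hderiv (egf cup_weight) = egf fall_weight * egf rise_weight"
  proof (rule hderiv_egf_min)
    fix u v :: "nat list" and m assume "\<forall>a\<in>set u \<union> set v. m < a"
    from ascents_split_min[OF this]
    show "cup_weight (u @ m # v) = fall_weight u * rise_weight v"
      using blocks_turn(2)[of "False # ascents u" "ascents v @ [True]"]
        blocks_turn(2)[of "[]" "ascents v @ [True]"] blocks_turn(2)[of "False # ascents u" "[]"]
      by (simp add: weight_defs power_add)
  qed (rule ascent_invariant_weights)+
  then show ?thesis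
    by (simp add: egf_def arr_sum_fall_weight)
qed

section \<open>The recurrences\<close>

lemma sum_perm_word:
  "(\<Sum>\<pi> | \<pi> permutes {1..n}. f (perm_word n \<pi>)) = (\<Sum>w\<in>permutations_of_set {1..n}. f w)"
proof -
  let ?P = "{\<pi>. \<pi> permutes {1..n}}"
  have set: "set [1..<n + 1] = {1..n}"
    by auto
  have inj: "inj_on (perm_word n) ?P"
  proof (rule inj_onI, rule ext)
    fix \<pi> \<sigma> i assume *: "\<pi> \<in> ?P" "\<sigma> \<in> ?P" "perm_word n \<pi> = perm_word n \<sigma>"
    show "\<pi> i = \<sigma> i"
    proof (cases "i \<in> {1..n}")
      case True
      then show ?thesis
        using *(3) unfolding perm_word_def map_eq_conv set by blast
    next
      case False
      then show ?thesis
        using *(1,2) by (simp add: permutes_not_in)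
    qed
  qed
  \<comment> \<open>Both sets have \<open>n!\<close> elements.\<close>
  have "perm_word n ` ?P = permutations_of_set {1..n}"
  proof (rule card_subset_eq)
    show "perm_word n ` ?P \<subseteq> permutations_of_set {1..n}"
    proof clarify
      fix \<pi> assume \<pi>: "\<pi> permutes {1..n}"
      show "perm_word n \<pi> \<in> permutations_of_set {1..n}"
        unfolding perm_word_def permutations_of_set_def mem_Collect_eq set_map distinct_map set
        using permutes_image[OF \<pi>] permutes_inj_on[OF \<pi>] by simp
    qed
    show "card (perm_word n ` ?P) = card (permutations_of_set {1..n})"
      using card_permutations[of "{1..n}" n] card_image[OF inj] by simp
  qed simp
  then show ?thesis
    using sum.reindex[OF inj, of f] by simp
qed

lemma R_eq_arr_sum: "R n = arr_sum run_weight n"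
proof -
  have "R n = (\<Sum>w\<in>permutations_of_set {1..n}. X ^ run w)"
    unfolding R_def by (rule sum_perm_word)
  also have "\<dots> = (\<Sum>w\<in>permutations_of_set {1..n}. run_weight w)"
    by (intro sum.cong) (simp_all add: run_weight_def run_eq_blocks permutations_of_setD(2))
  also have "\<dots> = arr_sum run_weight n"
    by (simp add: sum_permutations_of_set_invariant ascent_invariant_weights)
  finally show ?thesis .
qed

lemma S_eq_arr_sum: "S n = arr_sum up_weight n"
proof -
  have "S n = (\<Sum>w\<in>permutations_of_set {1..n}. X ^ run (0 # w))"
    unfolding S_def by (rule sum_perm_word)
  also have "\<dots> = (\<Sum>w\<in>permutations_of_set {1..n}. up_weight w)"
  proof (rule sum.cong)
    fix w assume "w \<in> permutations_of_set {1..n}"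
    then have w: "set w = {1..n}" "distinct w"
      by (rule permutations_of_setD)+
    then have "0 < hd w" if "w \<noteq> []"
      using hd_in_set[OF that] by simp
    then show "X ^ run (0 # w) = up_weight w"
      using w by (simp add: run_eq_blocks up_weight_def ascents_Cons)
  qed simp
  also have "\<dots> = arr_sum up_weight n"
    by (simp add: sum_permutations_of_set_invariant ascent_invariant_weights)
  finally show ?thesis .
qed

lemma shifted_R_eq_hnth: "R (Suc n) = hnth (egf up_weight ^ 2) n"
  using arg_cong[OF hderiv_egf_run_weight, of "\<lambda>f. hnth f n"]
  by (simp add: R_eq_arr_sum power2_eq_square)

lemma rise_series:
  "egf rise_weight * cosh_minus_sinh (1 - X ^ 2) = hconst X"
  by (rule peak_series_times_cosh_minus_sinh[OF hderiv_egf_rise_weight hderiv_egf_cup_weight])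
     (simp_all add: weight_defs)

theorem corollary14:
  shows
    "(\<forall>n\<ge>1. S (n + 1) =
        (of_nat n + X) * S n
        + (1 - X ^ 2) *
          (\<Sum>r = 2..n. of_nat (n choose (r - 2)) * (- 1) ^ (n - r + 1)
             * (1 - X ^ 2) ^ ((n - r) div 2) * S (r - 1))) \<and>
     (\<forall>n\<ge>1. R (n + 1) =
        2 * X * R n
        + (\<Sum>r = 2..n. of_nat ((n - 1) choose (r - 2)) * (- 1) ^ (n - r)
             * (1 - X ^ 2) ^ ((n - r + 1) div 2) * R r)) \<and>
     (\<forall>n\<ge>1. (1 + X) ^ (n div 2) dvd S n) \<and>
     (\<forall>n\<ge>2. (1 + X) ^ (n div 2 - 1) dvd R n)"
proof (intro conjI allI impI)
  fix n :: nat assume "n \<ge> 1"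
  then obtain m where m: "n = Suc m"
    by (cases n) auto
  let ?t = "\<lambda>k. of_nat (n choose k) * (- 1) ^ (n - k) * (1 - X ^ 2) ^ ((n - k) div 2) * S (Suc k)"
  have "S (n + 1) = X * S n - (\<Sum>k<n. ?t k)"
    using convolution_recurrence[of "egf up_weight" 1, OF _ rise_series, of n] hderiv_egf_up_weight
    by (simp add: S_eq_arr_sum)
  \<comment> \<open>The term at \<open>k = n - 1\<close> has exponent \<open>1 div 2 = 0\<close> and yields the summand \<open>n S(n)\<close>. In all the
    others the exponent is positive, so that a factor \<open>1 - x\<^sup>2\<close> can be taken out.\<close>
  also have "(\<Sum>k<n. ?t k) = (\<Sum>k<m. ?t k) - of_nat n * S n"
    by (simp add: m algebra_simps)
  also have "(\<Sum>k<m. ?t k) = (\<Sum>r = 2..n. - ((1 - X ^ 2) * (of_nat (n choose (r - 2))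
      * (- 1) ^ (n - r + 1) * (1 - X ^ 2) ^ ((n - r) div 2) * S (r - 1))))"
  proof (rule sum.reindex_bij_witness[of _ "\<lambda>r. r - 2" "\<lambda>k. k + 2"])
    fix k assume "k \<in> {..<m}"
    then obtain j where j: "m = Suc (k + j)"
      using less_imp_Suc_add by auto
    show "- ((1 - X ^ 2) * (of_nat (n choose (k + 2 - 2)) * (- 1) ^ (n - (k + 2) + 1)
        * (1 - X ^ 2) ^ ((n - (k + 2)) div 2) * S (k + 2 - 1))) = ?t k"
      by (simp add: m j mult_ac)
  qed (auto simp: m)
  finally show "S (n + 1) = (of_nat n + X) * S n + (1 - X ^ 2) *
      (\<Sum>r = 2..n. of_nat (n choose (r - 2)) * (- 1) ^ (n - r + 1)
         * (1 - X ^ 2) ^ ((n - r) div 2) * S (r - 1))"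
    by (simp add: sum_negf distrib_right flip: sum_distrib_left)
next
  fix n :: nat assume "n \<ge> 1"
  then obtain m where m: "n = Suc m"
    by (cases n) auto
  let ?t = "\<lambda>k. of_nat (m choose k) * (- 1) ^ (m - k) * (1 - X ^ 2) ^ ((m - k) div 2)
    * R (Suc (Suc k))"
  have "hderiv (egf up_weight ^ 2) = of_nat 2 * egf up_weight ^ 2 * egf rise_weight"
    by (rule hderiv_power_of_log_deriv) (rule hderiv_egf_up_weight)
  from convolution_recurrence[OF this rise_series, of m]
  have "R (n + 1) = 2 * X * R n - (\<Sum>k<m. ?t k)"
    by (simp add: shifted_R_eq_hnth m)
  also have "(\<Sum>k<m. ?t k) = (\<Sum>r = 2..n. - (of_nat ((n - 1) choose (r - 2)) * (- 1) ^ (n - r)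
             * (1 - X ^ 2) ^ ((n - r + 1) div 2) * R r))"
  proof (rule sum.reindex_bij_witness[of _ "\<lambda>r. r - 2" "\<lambda>k. k + 2"])
    fix k assume "k \<in> {..<m}"
    then obtain j where j: "m = Suc (k + j)"
      using less_imp_Suc_add by auto
    show "- (of_nat ((n - 1) choose (k + 2 - 2)) * (- 1) ^ (n - (k + 2))
        * (1 - X ^ 2) ^ ((n - (k + 2) + 1) div 2) * R (k + 2)) = ?t k"
      by (simp add: m j mult_ac)
  qed (auto simp: m)
  finally show "R (n + 1) = 2 * X * R n
      + (\<Sum>r = 2..n. of_nat ((n - 1) choose (r - 2)) * (- 1) ^ (n - r)
         * (1 - X ^ 2) ^ ((n - r + 1) div 2) * R r)"
    by (simp add: sum_negf)
next
  fix n :: nat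
  show "(1 + X) ^ (n div 2) dvd S n"
    using linear_power_dvd_hnth_power[OF hderiv_egf_up_weight hderiv_egf_rise_weight
        hderiv_egf_cup_weight, of n 1]
    by (simp add: S_eq_arr_sum weight_defs)
next
  fix n :: nat assume "n \<ge> 2"
  then obtain m where m: "n = Suc m" "m \<ge> 1"
    by (cases n) auto
  then have "n div 2 - 1 = (m + 1 - 2) div 2"
    by presburger
  with m show "(1 + X) ^ (n div 2 - 1) dvd R n"
    using linear_power_dvd_hnth_power[OF hderiv_egf_up_weight hderiv_egf_rise_weight
        hderiv_egf_cup_weight, of m 2]
    by (simp add: shifted_R_eq_hnth weight_defs)
qed

end
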